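(* Let $(\mathcal{X},p_a(y|x),p_d(y|x),p_T(t),\mathcal{Y})$ be a channel that dies. Then it is a finite-state semi-Markov channel, and when $T$ is a geometric random variable it is a finite-state Markov channel.
   Context: Channel that dies: finite input alphabet $\mathcal{X}$, finite output alphabet $\mathcal{Y}$ containing an erasure symbol $?$. There are two states, alive ($a$) and dead ($d$). In state $a$ the channel acts as a noisy discrete memoryless channel $p_a(y|x)$ that never outputs $?$; in state $d$ it outputs $?$ with probability 1 whatever the input. The state is $a$ at times $n=1,\dots,T$ and $d$ at times $n=T+1,T+2,\dots$, where $T$ is a random positive integer with distribution $p_T$. Finite-state channel: a channel with a finite set of states, in which the output at each time has conditional law determined by the current input and the current state. Semi-Markov process: a stochastic process with states in a discrete alphabet $\mathcal{S}$ such that whenever it enters state $s\in\mathcal{S}$: (i) the next state it will enter is $r$ with probability depending only on $s,r\in\mathcal{S}$; (ii) given that the next state to be entered is $r$, the time until the transition from $s$ to $r$ occurs has a distribution depending only on $s,r$. (The next state is allowed to be equal to the current state.) A finite-state channel is a finite-state semi-Markov channel if its state sequence forms a semi-Markov process, and a finite-state Markov channel if its state sequence forms a Markov chain. *)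

theory Defs
  imports "HOL-Probability.Probability"
begin

text \<open>Time runs over \<open>1, 2, \<dots>\<close>; values of sequences at index \<open>0\<close> are never used.\<close>

definition seq_space :: "(nat \<Rightarrow> 'a) measure" where
  "seq_space = (\<Pi>\<^sub>M n\<in>{1..}. count_space UNIV)"

text \<open>A channel with states assigns to every input sequence the joint law of the
  sequence of (state, output) pairs.\<close>

type_synonym ('x, 's, 'y) state_channel = "(nat \<Rightarrow> 'x) \<Rightarrow> (nat \<Rightarrow> 's \<times> 'y) measure"

definition state_at :: "nat \<Rightarrow> (nat \<Rightarrow> 's \<times> 'y) \<Rightarrow> 's" where
  "state_at n \<omega> = fst (\<omega> n)"

definition output_at :: "nat \<Rightarrow> (nat \<Rightarrow> 's \<times> 'y) \<Rightarrow> 'y" where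
  "output_at n \<omega> = snd (\<omega> n)"

text \<open>Given all past states and outputs and the current state, the output at time \<open>n\<close> has
  law \<open>W (S n) (x n)\<close>. As usual, conditional probabilities are only constrained
  when the conditioning event has positive probability.\<close>

definition finite_state_channel ::
    "('x::finite, 's::finite, 'y::finite) state_channel \<Rightarrow> bool" where
  "finite_state_channel K \<longleftrightarrow>
     (\<forall>x. prob_space (K x) \<and> sets (K x) = sets seq_space) \<and>
     (\<exists>W :: 's \<Rightarrow> 'x \<Rightarrow> 'y pmf. \<forall>x. \<forall>n\<ge>1. \<forall>h s y.
        \<P>(\<omega> in K x. state_at n \<omega> = s \<and> (\<forall>i\<in>{1..<n}. \<omega> i = h i)) > 0 \<longrightarrow>
        \<P>(\<omega> in K x. output_at n \<omega> = y \<bar> state_at n \<omega> = s \<and> (\<forall>i\<in>{1..<n}. \<omega> i = h i))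
          = pmf (W s (x n)) y)"

text \<open>\<open>N k\<close> is the time of the \<open>k\<close>-th entry into a state. A transition may lead back to the
  current state, so the entry times cannot be read off from the states alone and
  are existentially quantified. The event conditioned on is the full history of entered states
  and entry times up to the \<open>k\<close>-th entry; the probabilities given that history depend
  only on the state just entered (and, for the holding time, on the next one).\<close>

definition semi_markov_process ::
    "'w measure \<Rightarrow> (nat \<Rightarrow> 'w \<Rightarrow> 's::countable) \<Rightarrow> ('s \<Rightarrow> 's pmf) \<Rightarrow> ('s \<Rightarrow> 's \<Rightarrow> nat pmf) \<Rightarrow> bool"
where
  "semi_markov_process M S P F \<longleftrightarrow>
     prob_space M \<and> (\<forall>n\<ge>1. S n \<in> M \<rightarrow>\<^sub>M count_space UNIV) \<and>
     (\<exists>N :: nat \<Rightarrow> 'w \<Rightarrow> nat.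
        (\<forall>k. N k \<in> M \<rightarrow>\<^sub>M count_space {1..}) \<and>
        (AE \<omega> in M. N 0 \<omega> = 1 \<and>
           (\<forall>k. N k \<omega> < N (Suc k) \<omega> \<and>
                (\<forall>n\<in>{N k \<omega>..<N (Suc k) \<omega>}. S n \<omega> = S (N k \<omega>) \<omega>))) \<and>
        (\<forall>k j t r.
           \<P>(\<omega> in M. \<forall>i\<le>k. S (N i \<omega>) \<omega> = j i \<and> N i \<omega> = t i) > 0 \<longrightarrow>
           \<P>(\<omega> in M. S (N (Suc k) \<omega>) \<omega> = r \<bar> \<forall>i\<le>k. S (N i \<omega>) \<omega> = j i \<and> N i \<omega> = t i)
             = pmf (P (j k)) r) \<and>
        (\<forall>k j t r m.
           \<P>(\<omega> in M. S (N (Suc k) \<omega>) \<omega> = r \<and> (\<forall>i\<le>k. S (N i \<omega>) \<omega> = j i \<and> N i \<omega> = t i)) > 0 \<longrightarrow>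
           \<P>(\<omega> in M. N (Suc k) \<omega> - N k \<omega> = m \<bar>
                S (N (Suc k) \<omega>) \<omega> = r \<and> (\<forall>i\<le>k. S (N i \<omega>) \<omega> = j i \<and> N i \<omega> = t i))
             = pmf (F (j k) r) m))"

text \<open>Transition probabilities are time-homogeneous.\<close>

definition markov_chain ::
    "'w measure \<Rightarrow> (nat \<Rightarrow> 'w \<Rightarrow> 's::countable) \<Rightarrow> ('s \<Rightarrow> 's pmf) \<Rightarrow> bool" where
  "markov_chain M S Q \<longleftrightarrow>
     prob_space M \<and> (\<forall>n\<ge>1. S n \<in> M \<rightarrow>\<^sub>M count_space UNIV) \<and>
     (\<forall>n\<ge>1. \<forall>j r.
        \<P>(\<omega> in M. \<forall>i\<in>{1..n}. S i \<omega> = j i) > 0 \<longrightarrow>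
        \<P>(\<omega> in M. S (Suc n) \<omega> = r \<bar> \<forall>i\<in>{1..n}. S i \<omega> = j i) = pmf (Q (j n)) r)"

text \<open>That \<open>the\<close> state sequence is such a process means that the parameters, including the
  law \<open>\<mu>\<close> of the initial state, do not depend on the input sequence.\<close>

definition finite_state_semi_markov_channel ::
    "('x::finite, 's::finite, 'y::finite) state_channel \<Rightarrow> bool" where
  "finite_state_semi_markov_channel K \<longleftrightarrow>
     finite_state_channel K \<and>
     (\<exists>\<mu> P F. \<forall>x. (\<forall>s. \<P>(\<omega> in K x. state_at 1 \<omega> = s) = pmf \<mu> s) \<and>
                  semi_markov_process (K x) state_at P F)"

definition finite_state_markov_channel ::
    "('x::finite, 's::finite, 'y::finite) state_channel \<Rightarrow> bool" where
  "finite_state_markov_channel K \<longleftrightarrow>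
     finite_state_channel K \<and>
     (\<exists>\<mu> Q. \<forall>x. (\<forall>s. \<P>(\<omega> in K x. state_at 1 \<omega> = s) = pmf \<mu> s) \<and>
                markov_chain (K x) state_at Q)"

datatype life = Alive | Dead

instance life :: finite
proof
  have "(UNIV :: life set) \<subseteq> {Alive, Dead}"
    using life.exhaust by blast
  then show "finite (UNIV :: life set)"
    by (rule finite_subset) simp
qed

text \<open>\<open>e\<close> is the erasure symbol, \<open>pa\<close> and \<open>pd\<close> are the transition laws in the two states, and
  \<open>pT\<close> is the law of the last time at which the channel is alive.\<close>

definition channel_that_dies ::
    "'y \<Rightarrow> ('x \<Rightarrow> 'y pmf) \<Rightarrow> ('x \<Rightarrow> 'y pmf) \<Rightarrow> nat pmf \<Rightarrow> bool" where
  "channel_that_dies e pa pd pT \<longleftrightarrow>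
     (\<forall>x. e \<notin> set_pmf (pa x)) \<and> (\<forall>x. pd x = return_pmf e) \<and> 0 \<notin> set_pmf pT"

definition life_at :: "nat \<Rightarrow> nat \<Rightarrow> life" where
  "life_at t n = (if n \<le> t then Alive else Dead)"

definition letter_law :: "('x \<Rightarrow> 'y pmf) \<Rightarrow> ('x \<Rightarrow> 'y pmf) \<Rightarrow> life \<Rightarrow> 'x \<Rightarrow> 'y pmf" where
  "letter_law pa pd s = (case s of Alive \<Rightarrow> pa | Dead \<Rightarrow> pd)"

text \<open>Draw \<open>T = t\<close> from \<open>pT\<close>, independently of the inputs; given \<open>t\<close> the states are determined
  and the outputs at different times are independent.\<close>

definition dying_channel ::
    "('x \<Rightarrow> 'y pmf) \<Rightarrow> ('x \<Rightarrow> 'y pmf) \<Rightarrow> nat pmf \<Rightarrow> ('x, life, 'y) state_channel" where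
  "dying_channel pa pd pT x =
     measure_pmf pT \<bind> (\<lambda>t. \<Pi>\<^sub>M n\<in>{1..}.
       measure_pmf (map_pmf (Pair (life_at t n)) (letter_law pa pd (life_at t n) (x n))))"

text \<open>The library's \<open>geometric_pmf\<close> counts failures before the first success, hence the shift to
  the positive integers.\<close>

definition geometric_lifetime :: "nat pmf \<Rightarrow> bool" where
  "geometric_lifetime pT \<longleftrightarrow> (\<exists>p. 0 < p \<and> p \<le> 1 \<and> pT = map_pmf Suc (geometric_pmf p))"

end

theory Submission
  imports Defs
begin

text \<open>The state sequence is almost surely a function of the lifetime \<open>T\<close>, so probabilities of
  state events are probabilities under \<open>pT\<close>; for geometric \<open>T\<close> the Markov property is then
  memorylessness. For the outputs, condition on \<open>T = t\<close>: the coordinates are independent,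
  and the factor \<open>W s (x n) y\<close> does not depend on \<open>t\<close>, so it survives averaging over \<open>t\<close>.\<close>

section \<open>Product laws for a fixed lifetime and their mixture\<close>

definition fixed_lifetime_law ::
    "('x \<Rightarrow> 'y pmf) \<Rightarrow> ('x \<Rightarrow> 'y pmf) \<Rightarrow> (nat \<Rightarrow> 'x) \<Rightarrow> nat \<Rightarrow> (nat \<Rightarrow> life \<times> 'y) measure" where
  "fixed_lifetime_law pa pd x t = (\<Pi>\<^sub>M n\<in>{1..}.
     measure_pmf (map_pmf (Pair (life_at t n)) (letter_law pa pd (life_at t n) (x n))))"

lemma dying_channel_eq:
  "dying_channel pa pd pT x = measure_pmf pT \<bind> fixed_lifetime_law pa pd x"
  by (simp add: dying_channel_def fixed_lifetime_law_def[abs_def])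

lemma sets_fixed_lifetime_law: "sets (fixed_lifetime_law pa pd x t) = sets seq_space"
  unfolding fixed_lifetime_law_def seq_space_def by (intro sets_PiM_cong) auto

lemma space_fixed_lifetime_law: "space (fixed_lifetime_law pa pd x t) = space seq_space"
  by (rule sets_eq_imp_space_eq[OF sets_fixed_lifetime_law])

lemma prob_space_fixed_lifetime_law: "prob_space (fixed_lifetime_law pa pd x t)"
  unfolding fixed_lifetime_law_def by (intro prob_space_PiM prob_space_measure_pmf)

text \<open>The sigma-algebra of \<open>measure_pmf pT\<close> is discrete, so only membership in
  the space of subprobability measures has to be checked.\<close>

lemma fixed_lifetime_law_measurable:
  "fixed_lifetime_law pa pd x \<in> measure_pmf pT \<rightarrow>\<^sub>M subprob_algebra seq_space"
  by (auto simp: space_subprob_algebra sets_fixed_lifetime_law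
      intro!: prob_space_imp_subprob_space prob_space_fixed_lifetime_law)

lemma sets_dying_channel: "sets (dying_channel pa pd pT x) = sets seq_space"
  unfolding dying_channel_eq by (rule sets_bind) (auto simp: sets_fixed_lifetime_law)

lemma space_dying_channel: "space (dying_channel pa pd pT x) = space seq_space"
  by (rule sets_eq_imp_space_eq[OF sets_dying_channel])

lemma prob_space_dying_channel: "prob_space (dying_channel pa pd pT x)"
  unfolding dying_channel_eq
  by (intro measure_pmf.prob_space_bind[OF _ fixed_lifetime_law_measurable])
    (simp add: prob_space_fixed_lifetime_law)

lemma prob_dying_channel:
  assumes "Measurable.pred seq_space \<Phi>"
  shows "\<P>(\<omega> in dying_channel pa pd pT x. \<Phi> \<omega>) =
    (\<integral>t. \<P>(\<omega> in fixed_lifetime_law pa pd x t. \<Phi> \<omega>) \<partial>measure_pmf pT)"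
proof -
  have "{\<omega> \<in> space seq_space. \<Phi> \<omega>} \<in> sets seq_space"
    using assms by (simp add: pred_def)
  from measure_pmf.measure_bind[OF fixed_lifetime_law_measurable this]
  show ?thesis
    by (simp add: space_dying_channel space_fixed_lifetime_law dying_channel_eq[symmetric])
qed

section \<open>Measurability of coordinates, states and outputs\<close>

text \<open>Index 0 lies outside the index set of the product, where extensionality makes the
  coordinate constantly \<open>undefined\<close>. Covering it spares later measurability goals a
  side condition on the index.\<close>

lemma coordinate_measurable:
  "(\<lambda>\<omega>. \<omega> n) \<in> (seq_space :: (nat \<Rightarrow> 'a) measure) \<rightarrow>\<^sub>M count_space UNIV"
proof (cases "n \<ge> 1")
  case True
  then show ?thesis
    unfolding seq_space_def by (intro measurable_component_singleton) auto
next
  case False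
  then have "\<omega> n = undefined" if "\<omega> \<in> space (seq_space :: (nat \<Rightarrow> 'a) measure)" for \<omega>
    using that by (auto simp: seq_space_def space_PiM PiE_def extensional_def)
  then show ?thesis
    by (subst measurable_cong[where g = "\<lambda>_. undefined"]) auto
qed

lemma state_at_measurable [measurable]: "state_at n \<in> seq_space \<rightarrow>\<^sub>M count_space UNIV"
  unfolding state_at_def[abs_def] by (rule measurable_compose[OF coordinate_measurable]) simp

lemma output_at_measurable [measurable]: "output_at n \<in> seq_space \<rightarrow>\<^sub>M count_space UNIV"
  unfolding output_at_def[abs_def] by (rule measurable_compose[OF coordinate_measurable]) simp

lemma coordinate_eq_measurable: "Measurable.pred seq_space (\<lambda>\<omega>. \<omega> n = c)"
  by (rule measurable_compose[OF coordinate_measurable]) simp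

section \<open>State events as events about the lifetime\<close>

lemma AE_states_fixed_lifetime_law:
  "AE \<omega> in fixed_lifetime_law pa pd x t. \<forall>n\<ge>1. state_at n \<omega> = life_at t n"
proof -
  have "AE \<omega> in fixed_lifetime_law pa pd x t. n \<ge> 1 \<longrightarrow> state_at n \<omega> = life_at t n" for n
  proof (cases "n \<ge> 1")
    case True
    have "AE \<omega> in fixed_lifetime_law pa pd x t. fst (\<omega> n) = life_at t n"
      unfolding fixed_lifetime_law_def
      by (rule AE_PiM_component[where P = "\<lambda>z. fst z = life_at t n"])
        (use True in \<open>auto simp: AE_measure_pmf_iff prob_space_measure_pmf\<close>)
    then show ?thesis
      by (simp add: state_at_def)
  qed simp
  then show ?thesis
    by (simp add: AE_all_countable)
qed

text \<open>Both quantifiers range over countable sets, so the event is measurable and its almost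
  sure validity passes through the mixture. Keeping \<open>t\<close> in the support makes positivity
  of the lifetime available path by path.\<close>

lemma AE_states_dying_channel:
  "AE \<omega> in dying_channel pa pd pT x. \<exists>t\<in>set_pmf pT. \<forall>n\<ge>1. state_at n \<omega> = life_at t n"
proof -
  let ?P = "\<lambda>\<omega>. \<exists>t\<in>set_pmf pT. \<forall>n\<in>{1..}. state_at n \<omega> = life_at t n"
  have meas: "Measurable.pred seq_space ?P"
    by measurable
  have "AE \<omega> in fixed_lifetime_law pa pd x t. ?P \<omega>" if "t \<in> set_pmf pT" for t
    using AE_states_fixed_lifetime_law[of t pa pd x]
    by (rule eventually_mono) (use that in auto)
  then have "AE t in measure_pmf pT. AE \<omega> in fixed_lifetime_law pa pd x t. ?P \<omega>"
    by (rule AE_pmfI)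
  then have "AE \<omega> in dying_channel pa pd pT x. ?P \<omega>"
    unfolding dying_channel_eq AE_bind[OF fixed_lifetime_law_measurable meas] .
  then show ?thesis
    by (simp add: Ball_def)
qed

text \<open>Given a lifetime \<open>t\<close> in the support, the event has probability 1 or 0
  according to \<open>\<psi> t\<close>; averaging leaves the mass of the lifetimes satisfying
  \<open>\<psi>\<close>. This turns the semi-Markov and Markov conditions into computations with
  \<open>pT\<close>.\<close>

lemma prob_state_event:
  assumes \<Phi>: "Measurable.pred seq_space \<Phi>"
    and eq: "\<And>t \<omega>. t \<in> set_pmf pT \<Longrightarrow> \<forall>n\<ge>1. state_at n \<omega> = life_at t n \<Longrightarrow> \<Phi> \<omega> \<longleftrightarrow> \<psi> t"
  shows "\<P>(\<omega> in dying_channel pa pd pT x. \<Phi> \<omega>) = measure_pmf.prob pT {t. \<psi> t}"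
proof -
  have "\<P>(\<omega> in fixed_lifetime_law pa pd x t. \<Phi> \<omega>) = indicator {t. \<psi> t} t"
    if "t \<in> set_pmf pT" for t
  proof -
    interpret prob_space "fixed_lifetime_law pa pd x t"
      by (rule prob_space_fixed_lifetime_law)
    have "AE \<omega> in fixed_lifetime_law pa pd x t. \<Phi> \<omega> \<longleftrightarrow> \<psi> t"
      using AE_states_fixed_lifetime_law[of t pa pd x] by eventually_elim (use eq that in auto)
    moreover have "{\<omega> \<in> space (fixed_lifetime_law pa pd x t). \<Phi> \<omega>} \<in> events"
      using \<Phi> by (simp add: sets_fixed_lifetime_law space_fixed_lifetime_law pred_def)
    ultimately show ?thesis
      by (cases "\<psi> t") (simp_all add: prob_Collect_eq_1 prob_Collect_eq_0)
  qed
  then have "\<P>(\<omega> in dying_channel pa pd pT x. \<Phi> \<omega>) = (\<integral>t. indicator {t. \<psi> t} t \<partial>measure_pmf pT)"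
    unfolding prob_dying_channel[OF \<Phi>] by (intro integral_cong_AE) (auto simp: AE_measure_pmf_iff)
  then show ?thesis
    by simp
qed

lemma prob_initial_state:
  assumes "0 \<notin> set_pmf pT"
  shows "\<P>(\<omega> in dying_channel pa pd pT x. state_at 1 \<omega> = s) = pmf (return_pmf Alive) s"
proof -
  \<comment> \<open>The condition does not mention the lifetime: every lifetime in the support is at
    least 1, so the set is everything or empty.\<close>
  have "\<P>(\<omega> in dying_channel pa pd pT x. state_at 1 \<omega> = s)
      = measure_pmf.prob pT {t. s = Alive}"
    by (rule prob_state_event) (use assms in \<open>auto simp: life_at_def not_less_eq_eq\<close>)
  then show ?thesis
    by (cases s) auto
qed

section \<open>Conditional law of the outputs\<close>

text \<open>Independence of the coordinates. The set \<open>A\<close> is arbitrary so that the same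
  factor for the past appears whether state and output are both prescribed or only the
  state.\<close>

lemma prob_past_and_letter:
  assumes "n \<ge> 1"
  shows "\<P>(\<omega> in fixed_lifetime_law pa pd x t. \<omega> n \<in> A \<and> (\<forall>i\<in>{1..<n}. \<omega> i = h i))
    = measure_pmf.prob (map_pmf (Pair (life_at t n)) (letter_law pa pd (life_at t n) (x n))) A
      * (\<Prod>i\<in>{1..<n}. pmf (map_pmf (Pair (life_at t i)) (letter_law pa pd (life_at t i) (x i))) (h i))"
proof -
  define M where "M i = map_pmf (Pair (life_at t i)) (letter_law pa pd (life_at t i) (x i))" for i
  interpret product_prob_space "\<lambda>i. measure_pmf (M i)" "{1..}"
    by unfold_locales
  \<comment> \<open>The event is a cylinder over \<open>{1..n}\<close>, with singletons in the past
    and \<open>A\<close> at time \<open>n\<close>.\<close>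
  define X where "X = (\<lambda>i. {h i})(n := A)"
  have set_eq: "{1..n} = insert n {1..<n}"
    using assms by auto
  have "\<P>(\<omega> in fixed_lifetime_law pa pd x t. \<omega> n \<in> A \<and> (\<forall>i\<in>{1..<n}. \<omega> i = h i))
     = \<P>(\<omega> in PiM {1..} (\<lambda>i. measure_pmf (M i)). \<forall>i\<in>{1..n}. \<omega> i \<in> X i)"
    unfolding fixed_lifetime_law_def M_def set_eq
    by (intro arg_cong2[where f = measure] refl) (auto simp: X_def)
  also have "\<dots> = (\<Prod>i\<in>{1..n}. measure_pmf.prob (M i) (X i))"
  proof -
    have "emeasure (PiM {1..} (\<lambda>i. measure_pmf (M i)))
        {\<omega> \<in> space (PiM {1..} (\<lambda>i. measure_pmf (M i))). \<forall>i\<in>{1..n}. \<omega> i \<in> X i}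
        = (\<Prod>i\<in>{1..n}. emeasure (M i) (X i))"
      by (rule emeasure_PiM_Collect) auto
    then show ?thesis
      unfolding P.emeasure_eq_measure measure_pmf.emeasure_eq_measure
      by (simp add: prod_ennreal prod_nonneg)
  qed
  also have "\<dots> = measure_pmf.prob (M n) A * (\<Prod>i\<in>{1..<n}. pmf (M i) (h i))"
    unfolding set_eq by (simp add: X_def measure_pmf_single)
  finally show ?thesis
    unfolding M_def .
qed

text \<open>The factor of the past is common to both sides, so only the current letter matters. Its
  state is deterministic: if it differs from \<open>s\<close>, both sides vanish; otherwise the
  output is drawn from \<open>letter_law pa pd s (x n)\<close>.\<close>

lemma prob_letter_given_past_fixed_lifetime:
  fixes pa pd :: "'x \<Rightarrow> 'y pmf"
  assumes "n \<ge> 1"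
  shows "\<P>(\<omega> in fixed_lifetime_law pa pd x t.
      output_at n \<omega> = y \<and> state_at n \<omega> = s \<and> (\<forall>i\<in>{1..<n}. \<omega> i = h i))
    = pmf (letter_law pa pd s (x n)) y *
      \<P>(\<omega> in fixed_lifetime_law pa pd x t. state_at n \<omega> = s \<and> (\<forall>i\<in>{1..<n}. \<omega> i = h i))"
proof -
  have "(output_at n \<omega> = y \<and> state_at n \<omega> = s \<and> (\<forall>i\<in>{1..<n}. \<omega> i = h i)) \<longleftrightarrow>
      \<omega> n \<in> {(s, y)} \<and> (\<forall>i\<in>{1..<n}. \<omega> i = h i)" for \<omega>
    by (cases "\<omega> n") (auto simp: output_at_def state_at_def)
  moreover have "(state_at n \<omega> = s \<and> (\<forall>i\<in>{1..<n}. \<omega> i = h i)) \<longleftrightarrow>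
      \<omega> n \<in> {s} \<times> UNIV \<and> (\<forall>i\<in>{1..<n}. \<omega> i = h i)" for \<omega> :: "nat \<Rightarrow> life \<times> 'y"
    by (cases "\<omega> n") (auto simp: state_at_def)
  moreover have "measure_pmf.prob (map_pmf (Pair l) (letter_law pa pd l (x n))) {(s, y)}
      = pmf (letter_law pa pd s (x n)) y *
        measure_pmf.prob (map_pmf (Pair l) (letter_law pa pd l (x n))) ({s} \<times> UNIV)" for l
  proof -
    have "Pair l -` {(s, y)} = (if l = s then {y} else {})"
      "Pair l -` ({s} \<times> UNIV) = (if l = s then UNIV else {})"
      by auto
    then show ?thesis
      unfolding measure_map_pmf by (simp add: measure_pmf_single)
  qed
  ultimately show ?thesis
    by (simp only: prob_past_and_letter[OF assms] mult.assoc)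
qed

lemma finite_state_channel_dying:
  fixes pa pd :: "'x::finite \<Rightarrow> 'y::finite pmf"
  shows "finite_state_channel (dying_channel pa pd pT)"
  unfolding finite_state_channel_def
proof (intro conjI allI exI[of _ "letter_law pa pd"] impI)
  fix x :: "nat \<Rightarrow> 'x"
  show "prob_space (dying_channel pa pd pT x)" "sets (dying_channel pa pd pT x) = sets seq_space"
    by (rule prob_space_dying_channel sets_dying_channel)+
next
  fix x :: "nat \<Rightarrow> 'x" and n and h :: "nat \<Rightarrow> life \<times> 'y" and s y
  let ?K = "dying_channel pa pd pT x"
  let ?past = "\<lambda>\<omega>. state_at n \<omega> = s \<and> (\<forall>i\<in>{1..<n}. \<omega> i = h i)"
  assume n: "n \<ge> 1" and pos: "\<P>(\<omega> in ?K. ?past \<omega>) > 0"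
  \<comment> \<open>Averaging over lifetimes preserves this linear identity between joint
    probabilities; division by the probability of the past comes last.\<close>
  have "\<P>(\<omega> in ?K. output_at n \<omega> = y \<and> ?past \<omega>)
      = pmf (letter_law pa pd s (x n)) y * \<P>(\<omega> in ?K. ?past \<omega>)"
  proof -
    note [measurable] = coordinate_eq_measurable
    have meas: "Measurable.pred seq_space (\<lambda>\<omega>. output_at n \<omega> = y \<and> ?past \<omega>)"
      "Measurable.pred seq_space ?past"
      by measurable
    show ?thesis
      unfolding meas[THEN prob_dying_channel] prob_letter_given_past_fixed_lifetime[OF n] by simp
  qed
  then show "\<P>(\<omega> in ?K. output_at n \<omega> = y \<bar> ?past \<omega>) = pmf (letter_law pa pd s (x n)) y"
    using pos by (simp add: cond_prob_def)
qed

section \<open>Entry times and the semi-Markov property\<close>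

definition lifetime :: "(nat \<Rightarrow> life \<times> 'y) \<Rightarrow> nat" where
  "lifetime \<omega> = (LEAST n. state_at (Suc n) \<omega> = Dead)"

lemma lifetime_eq:
  assumes "\<forall>n\<ge>1. state_at n \<omega> = life_at t n"
  shows "lifetime \<omega> = t"
  unfolding lifetime_def
  by (rule Least_equality) (use assms in \<open>auto simp: life_at_def split: if_splits\<close>)

lemma lifetime_measurable [measurable]: "lifetime \<in> seq_space \<rightarrow>\<^sub>M count_space UNIV"
  unfolding lifetime_def[abs_def] by measurable

text \<open>Death is the first transition; from then on the dead state re-enters itself at every step.\<close>

definition entry_time :: "nat \<Rightarrow> (nat \<Rightarrow> life \<times> 'y) \<Rightarrow> nat" where
  "entry_time k \<omega> = (if k = 0 then 1 else lifetime \<omega> + k)"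

lemma entry_time_eq:
  assumes "\<forall>n\<ge>1. state_at n \<omega> = life_at t n"
  shows "entry_time k \<omega> = (if k = 0 then 1 else t + k)"
  using lifetime_eq[OF assms] by (simp add: entry_time_def)

lemma entered_state_eq:
  assumes "\<forall>n\<ge>1. state_at n \<omega> = life_at t n" "t \<ge> 1"
  shows "state_at (entry_time k \<omega>) \<omega> = (if k = 0 then Alive else Dead)"
  using assms by (simp add: entry_time_eq[OF assms(1)] life_at_def)

lemma entry_time_measurable [measurable]: "entry_time k \<in> seq_space \<rightarrow>\<^sub>M count_space UNIV"
  unfolding entry_time_def[abs_def] by measurable

text \<open>The time of evaluation is random but takes countably many values.\<close>

lemma entered_state_measurable [measurable]:
  "(\<lambda>\<omega>. state_at (entry_time k \<omega>) \<omega>) \<in> seq_space \<rightarrow>\<^sub>M count_space UNIV"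
  by (rule measurable_compose_countable[OF state_at_measurable entry_time_measurable])

text \<open>The entered states are almost surely \<open>Alive\<close>, \<open>Dead\<close>,
  \<open>Dead\<close>, and so on. All randomness sits in the first holding time, which is
  \<open>T\<close> because the alive state is entered at time 1 and left at time
  \<open>T + 1\<close>.\<close>

lemma semi_markov_process_dying:
  fixes pa pd :: "'x \<Rightarrow> 'y pmf"
  assumes "0 \<notin> set_pmf pT"
  shows "semi_markov_process (dying_channel pa pd pT x) state_at (\<lambda>_. return_pmf Dead)
    (\<lambda>s _. case s of Alive \<Rightarrow> pT | Dead \<Rightarrow> return_pmf 1)"
  unfolding semi_markov_process_def
proof (intro conjI allI impI exI[of _ entry_time])
  let ?K = "dying_channel pa pd pT x"
  note [measurable_cong] = sets_dying_channel[of pa pd pT x]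
  let ?F = "\<lambda>s (_::life). case s of Alive \<Rightarrow> pT | Dead \<Rightarrow> return_pmf 1"
  have T_pos: "t \<ge> 1" if "t \<in> set_pmf pT" for t
    using assms that by (cases t) auto
  show "prob_space ?K"
    by (rule prob_space_dying_channel)
  show "state_at n \<in> ?K \<rightarrow>\<^sub>M count_space UNIV" for n
    by measurable
  show "entry_time k \<in> ?K \<rightarrow>\<^sub>M count_space {1..}" for k
  proof -
    \<comment> \<open>The target space \<open>{1..}\<close> requires positivity on every path, not
      just almost surely; the form \<open>Suc (... - 1)\<close> makes it visible.\<close>
    have "(\<lambda>\<omega>. Suc (entry_time k \<omega> - 1)) \<in> ?K \<rightarrow>\<^sub>M count_space {1..}"
      by (rule measurable_compose[of "\<lambda>\<omega>. entry_time k \<omega> - 1" _ "count_space UNIV"]) auto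
    moreover have "(\<lambda>\<omega> :: nat \<Rightarrow> life \<times> 'y. Suc (entry_time k \<omega> - 1)) = entry_time k"
      by (auto simp: entry_time_def)
    ultimately show ?thesis
      by (simp only:)
  qed
  show "AE \<omega> in ?K. entry_time 0 \<omega> = 1 \<and> (\<forall>k. entry_time k \<omega> < entry_time (Suc k) \<omega> \<and>
      (\<forall>n\<in>{entry_time k \<omega>..<entry_time (Suc k) \<omega>}.
        state_at n \<omega> = state_at (entry_time k \<omega>) \<omega>))"
    using AE_states_dying_channel
  proof eventually_elim
    fix \<omega> :: "nat \<Rightarrow> life \<times> 'y"
    assume "\<exists>t\<in>set_pmf pT. \<forall>n\<ge>1. state_at n \<omega> = life_at t n"
    then obtain t where t: "t \<in> set_pmf pT" "\<forall>n\<ge>1. state_at n \<omega> = life_at t n"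
      by blast
    show "entry_time 0 \<omega> = 1 \<and> (\<forall>k. entry_time k \<omega> < entry_time (Suc k) \<omega> \<and>
      (\<forall>n\<in>{entry_time k \<omega>..<entry_time (Suc k) \<omega>}.
        state_at n \<omega> = state_at (entry_time k \<omega>) \<omega>))"
      using T_pos[OF t(1)] t(2)
      by (auto simp: entered_state_eq[OF t(2)] entry_time_eq[OF t(2)] life_at_def)
  qed
  fix k and j :: "nat \<Rightarrow> life" and t :: "nat \<Rightarrow> nat" and r
  let ?hist = "\<lambda>\<omega>. \<forall>i\<le>k. state_at (entry_time i \<omega>) \<omega> = j i \<and> entry_time i \<omega> = t i"
  \<comment> \<open>The history expressed through the lifetime alone.\<close>
  define H where "H T \<longleftrightarrow>
    (\<forall>i\<le>k. (if i = 0 then Alive else Dead) = j i \<and> (if i = 0 then 1 else T + i) = t i)" for T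
  have hist: "?hist \<omega> \<longleftrightarrow> H T"
    if "T \<in> set_pmf pT" "\<forall>n\<ge>1. state_at n \<omega> = life_at T n" for \<omega> :: "nat \<Rightarrow> life \<times> 'y" and T
    unfolding H_def entered_state_eq[OF that(2) T_pos[OF that(1)]]
    unfolding entry_time_eq[OF that(2)] ..
  have meas_hist: "Measurable.pred seq_space ?hist"
    by measurable
  have prob_hist: "\<P>(\<omega> in ?K. ?hist \<omega>) = measure_pmf.prob pT {T. H T}"
    by (rule prob_state_event[OF meas_hist hist])
  have next_state: "state_at (entry_time (Suc k) \<omega>) \<omega> = r \<longleftrightarrow> r = Dead"
    if "T \<in> set_pmf pT" "\<forall>n\<ge>1. state_at n \<omega> = life_at T n" for \<omega> :: "nat \<Rightarrow> life \<times> 'y" and T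
    by (auto simp: entered_state_eq[OF that(2) T_pos[OF that(1)]])
  have meas_next: "Measurable.pred seq_space
      (\<lambda>\<omega>. state_at (entry_time (Suc k) \<omega>) \<omega> = r \<and> ?hist \<omega>)"
    by (intro pred_intros_logic meas_hist) measurable
  have prob_next: "\<P>(\<omega> in ?K. state_at (entry_time (Suc k) \<omega>) \<omega> = r \<and> ?hist \<omega>)
      = measure_pmf.prob pT {T. r = Dead \<and> H T}"
    by (rule prob_state_event[OF meas_next]) (simp only: hist next_state)
  show "\<P>(\<omega> in ?K. state_at (entry_time (Suc k) \<omega>) \<omega> = r \<bar> ?hist \<omega>) = pmf (return_pmf Dead) r"
    if "\<P>(\<omega> in ?K. ?hist \<omega>) > 0"
    using that unfolding cond_prob_def prob_hist prob_next by (cases r) auto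
  fix m
  assume pos: "\<P>(\<omega> in ?K. state_at (entry_time (Suc k) \<omega>) \<omega> = r \<and> ?hist \<omega>) > 0"
  have hold: "entry_time (Suc k) \<omega> - entry_time k \<omega> = m \<longleftrightarrow> (if k = 0 then T else 1) = m"
    if "\<forall>n\<ge>1. state_at n \<omega> = life_at T n" for \<omega> :: "nat \<Rightarrow> life \<times> 'y" and T
    by (simp add: entry_time_eq[OF that])
  have meas_hold: "Measurable.pred seq_space (\<lambda>\<omega>. entry_time (Suc k) \<omega> - entry_time k \<omega> = m \<and>
      state_at (entry_time (Suc k) \<omega>) \<omega> = r \<and> ?hist \<omega>)"
    by (intro pred_intros_logic(3)[OF _ meas_next]) measurable
  have prob_hold: "\<P>(\<omega> in ?K. entry_time (Suc k) \<omega> - entry_time k \<omega> = m \<and>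
        state_at (entry_time (Suc k) \<omega>) \<omega> = r \<and> ?hist \<omega>)
      = measure_pmf.prob pT {T. (if k = 0 then T else 1) = m \<and> r = Dead \<and> H T}"
    by (rule prob_state_event[OF meas_hold]) (simp only: hist next_state hold)
  \<comment> \<open>Positive probability yields a lifetime compatible with the history, which forces
    \<open>r = Dead\<close> and determines \<open>j k\<close>.\<close>
  have "{T. r = Dead \<and> H T} \<noteq> {}"
    using pos unfolding prob_next by (metis less_irrefl measure_empty)
  then obtain T where T: "r = Dead" "H T"
    by blast
  show "\<P>(\<omega> in ?K. entry_time (Suc k) \<omega> - entry_time k \<omega> = m \<bar>
      state_at (entry_time (Suc k) \<omega>) \<omega> = r \<and> ?hist \<omega>) = pmf (?F (j k) r) m"
  proof (cases "k = 0")
    case True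
    \<comment> \<open>Before the first transition the history carries no information about
      \<open>T\<close>, so conditioning leaves \<open>pT\<close> unchanged.\<close>
    then have "j k = Alive" "H = (\<lambda>_. True)"
      using T(2) by (auto simp: H_def)
    then show ?thesis
      using True T(1) unfolding cond_prob_def prob_hold prob_next
      by (simp add: measure_pmf_single)
  next
    case False
    then have "j k = Dead"
      using T(2) by (auto simp: H_def)
    then show ?thesis
      using False pos unfolding cond_prob_def prob_hold prob_next
      by (cases "m = 1") auto
  qed
qed

section \<open>Geometric lifetimes and the Markov property\<close>

text \<open>The first \<open>n\<close> trials must all fail; the computation takes the complement of
  a finite geometric sum.\<close>

lemma prob_geometric_at_least:
  assumes "0 < p" "p \<le> 1"
  shows "measure_pmf.prob (geometric_pmf p) {n..} = (1 - p) ^ n"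
proof -
  have "measure_pmf.prob (geometric_pmf p) {..<n} = (\<Sum>i<n. (1 - p) ^ i * p)"
    using assms by (simp add: measure_measure_pmf_finite)
  also have "\<dots> = 1 - (1 - p) ^ n"
    using assms by (simp flip: sum_distrib_right add: sum_gp_strict)
  finally have "1 - measure_pmf.prob (geometric_pmf p) {..<n} = (1 - p) ^ n"
    by simp
  moreover have "UNIV - {..<n} = {n..}"
    by auto
  ultimately show ?thesis
    using measure_pmf.prob_compl[of "{..<n}" "geometric_pmf p"] by simp
qed

text \<open>One Bernoulli trial per step decides survival whatever the age, success meaning death;
  the dead state is absorbing.\<close>

lemma markov_chain_dying:
  assumes p: "0 < p" "p \<le> 1" and pT: "pT = map_pmf Suc (geometric_pmf p)"
  shows "markov_chain (dying_channel pa pd pT x) state_at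
    (\<lambda>s. case s of Alive \<Rightarrow> map_pmf (\<lambda>b. if b then Dead else Alive) (bernoulli_pmf p)
                | Dead \<Rightarrow> return_pmf Dead)"
  unfolding markov_chain_def
proof (intro conjI allI impI)
  let ?K = "dying_channel pa pd pT x"
  note [measurable_cong] = sets_dying_channel[of pa pd pT x]
  let ?step = "map_pmf (\<lambda>b. if b then Dead else Alive) (bernoulli_pmf p)"
  show "prob_space ?K"
    by (rule prob_space_dying_channel)
  show "state_at n \<in> ?K \<rightarrow>\<^sub>M count_space UNIV" for n
    by measurable
  fix n and j :: "nat \<Rightarrow> life" and r
  let ?hist = "\<lambda>\<omega>. \<forall>i\<in>{1..n}. state_at i \<omega> = j i"
  let ?histT = "\<lambda>t. \<forall>i\<in>{1..n}. life_at t i = j i"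
  assume n: "n \<ge> 1" and pos: "\<P>(\<omega> in ?K. ?hist \<omega>) > 0"
  have meas: "Measurable.pred seq_space ?hist"
    by (intro pred_intros_finite) auto
  have meas_next: "Measurable.pred seq_space (\<lambda>\<omega>. state_at (Suc n) \<omega> = r \<and> ?hist \<omega>)"
    by (intro pred_intros_logic meas) auto
  have prob_hist: "\<P>(\<omega> in ?K. ?hist \<omega>) = measure_pmf.prob pT {t. ?histT t}"
    by (rule prob_state_event[OF meas]) simp
  have prob_next: "\<P>(\<omega> in ?K. state_at (Suc n) \<omega> = r \<and> ?hist \<omega>)
      = measure_pmf.prob pT {t. life_at t (Suc n) = r \<and> ?histT t}"
    by (rule prob_state_event[OF meas_next]) simp
  have "{t. ?histT t} \<noteq> {}"
    using pos unfolding prob_hist by (metis less_irrefl measure_empty)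
  then obtain T where T: "?histT T"
    by blast
  show "\<P>(\<omega> in ?K. state_at (Suc n) \<omega> = r \<bar> ?hist \<omega>)
      = pmf (case j n of Alive \<Rightarrow> ?step | Dead \<Rightarrow> return_pmf Dead) r"
  proof (cases "j n")
    case Dead
    have "life_at t (Suc n) = Dead" if "?histT t" for t
      using that[rule_format, of n] n Dead by (auto simp: life_at_def split: if_splits)
    then have "{t. life_at t (Suc n) = r \<and> ?histT t} = (if r = Dead then {t. ?histT t} else {})"
      by auto
    then show ?thesis
      using pos Dead unfolding cond_prob_def prob_hist prob_next by auto
  next
    case Alive
    \<comment> \<open>Because of the shift by \<open>Suc\<close>, a lifetime of at least
      \<open>k\<close> means \<open>k - 1\<close> initial failures.\<close>
    have tail: "measure_pmf.prob pT {k..} = (1 - p) ^ (k - 1)" if "k \<ge> 1" for k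
    proof -
      have "Suc -` {k..} = {k - 1..}"
        using that by auto
      then show ?thesis
        by (simp add: pT prob_geometric_at_least p)
    qed
    have "n \<le> T"
      using T[rule_format, of n] n Alive by (auto simp: life_at_def split: if_splits)
    \<comment> \<open>Being alive at time \<open>n\<close> forces being alive before, so the whole
      history reduces to \<open>n \<le> t\<close>.\<close>
    then have "j i = Alive" if "i \<in> {1..n}" for i
      using T[rule_format, OF that] that by (auto simp: life_at_def)
    then have histT: "?histT t \<longleftrightarrow> n \<le> t" for t
      using n by (auto simp: life_at_def)
    have hist_tail: "measure_pmf.prob pT {t. ?histT t} = (1 - p) ^ (n - 1)"
      using tail[OF n] unfolding histT atLeast_def .
    have alive_tail: "measure_pmf.prob pT {Suc n..} = (1 - p) * (1 - p) ^ (n - 1)"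
      using tail[of "Suc n"] n by (simp flip: power_Suc)
    \<comment> \<open>Isolates the mass of dying right after time \<open>n\<close>, namely
      \<open>p * (1 - p) ^ (n - 1)\<close>.\<close>
    have split: "measure_pmf.prob pT {n..} = measure_pmf.prob pT {n} + measure_pmf.prob pT {Suc n..}"
      by (subst measure_pmf.finite_measure_Union[symmetric])
        (auto intro!: arg_cong[where f = "measure_pmf.prob pT"])
    have "{t. life_at t (Suc n) = r \<and> ?histT t} = (if r = Alive then {Suc n..} else {n})"
      unfolding histT by (cases r) (auto simp: life_at_def split: if_splits)
    then have "measure_pmf.prob pT {t. life_at t (Suc n) = r \<and> ?histT t}
        = (if r = Alive then 1 - p else p) * (1 - p) ^ (n - 1)"
      using alive_tail split tail[OF n] by (auto simp: algebra_simps)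
    moreover have "pmf ?step r = (if r = Alive then 1 - p else p)"
    proof -
      have "(\<lambda>b. if b then Dead else Alive) -` {r} = {r = Dead}"
        by (cases r) (auto split: if_splits)
      then show ?thesis
        using p by (cases r) (simp_all add: pmf_map measure_pmf_single)
    qed
    \<comment> \<open>For \<open>p = 1\<close> this power vanishes when \<open>n > 1\<close>;
      positivity of the conditioning event excludes that case.\<close>
    moreover have "(1 - p) ^ (n - 1) \<noteq> 0"
      using pos unfolding prob_hist hist_tail by linarith
    ultimately show ?thesis
      unfolding cond_prob_def prob_hist prob_next hist_tail Alive
      by (simp only: life.case nonzero_mult_div_cancel_right simp_thms)
  qed
qed

theorem proposition3:
  fixes e :: "'y::finite"
    and pa pd :: "'x::finite \<Rightarrow> 'y pmf"
    and pT :: "nat pmf"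
  assumes "channel_that_dies e pa pd pT"
  shows "finite_state_semi_markov_channel (dying_channel pa pd pT) \<and>
         (geometric_lifetime pT \<longrightarrow> finite_state_markov_channel (dying_channel pa pd pT))"
proof -
  have pos: "0 \<notin> set_pmf pT"
    using assms by (simp add: channel_that_dies_def)
  show ?thesis
    unfolding finite_state_semi_markov_channel_def finite_state_markov_channel_def
      geometric_lifetime_def
    \<comment> \<open>The initial law and the kernels in these facts are the same for all inputs
      \<open>x\<close>, so they can be chosen before \<open>x\<close>.\<close>
    using finite_state_channel_dying[of pa pd pT] prob_initial_state[OF pos, of pa pd]
      semi_markov_process_dying[OF pos, of pa pd] markov_chain_dying[of _ pT pa pd]
    by blast
qed

end
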